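(* Let $b\ge3$ and $m\ge2$ be integers. The set $\mathcal{A}=\{A_{\mathbf{d}}:\mathbf{d}\in D_b^m\}$ has the finiteness property. Furthermore, for any periodic and progressively overlapping sequence $\omega=(\omega^0\omega^1\ldots\omega^{n-1})^\infty\in(D_b^m)^{\mathbb{N}_0}$ we have $$\widehat\rho(\mathcal A)=\rho(A_{\omega^0}A_{\omega^1}\cdots A_{\omega^{n-1}})^{1/n}=\lambda,$$ where $\lambda\in(b-1,b)$ is the Pisot number satisfying $x^m-(b-1)(x^{m-1}+x^{m-2}+\cdots+x+1)=0$.
   Context: $\mathbb{N}=\{1,2,\ldots\}$, $\mathbb{N}_0=\mathbb{N}\cup\{0\}$, $D_b=\{0,1,\ldots,b-1\}$; $D_b^n$ is the set of words of length $n$ over $D_b$. $(D_b^m)^{\mathbb{N}_0}$ is the set of infinite sequences $\omega=\omega^0\omega^1\ldots$ with each $\omega^k=\omega^k_1\ldots\omega^k_m\in D_b^m$ (superscripts are indices); $(\omega^0\ldots\omega^{n-1})^\infty$ is the periodic sequence obtained by repeating the block $\omega^0\ldots\omega^{n-1}$. The sequence $\omega$ is progressively overlapping if $\omega^i_1\ldots\omega^i_{m-1}=\omega^{i-1}_2\ldots\omega^{i-1}_m$ for all $i\in\mathbb{N}$. For $\mathbf{d}\in D_b^m$, $A_{\mathbf{d}}$ is the $b^{m-1}\times b^{m-1}$ adjacency $0$-$1$ matrix of the directed graph with vertex set $D_b^{m-1}$ in which there is an edge from $u_1\ldots u_{m-1}$ to $v_1\ldots v_{m-1}$ if and only if $u_2\ldots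 u_{m-1}=v_1\ldots v_{m-2}$ and $u_1\ldots u_{m-1}v_{m-1}\ne\mathbf{d}$. $\rho(M)$ is the spectral radius of a square matrix $M$, and $\|A\|=\sum_{i,j}|a_{i,j}|$. For a finite set $\mathcal{M}=\{M_1,\ldots,M_r\}$ of $d\times d$ real matrices, the joint spectral radius is $\widehat\rho(\mathcal{M})=\lim_{n\to\infty}\sup_{i_1\ldots i_n\in\{1,\ldots,r\}^n}\|M_{i_1}\cdots M_{i_n}\|^{1/n}$, and $\mathcal{M}$ has the finiteness property if there are $n\in\mathbb{N}$ and $i_1\ldots i_n\in\{1,\ldots,r\}^n$ with $\widehat\rho(\mathcal{M})=\rho(M_{i_1}\cdots M_{i_n})^{1/n}$. A Pisot number is an algebraic integer greater than $1$ whose algebraic conjugates (other than itself) have modulus strictly less than $1$. *)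

theory Defs
  imports "Jordan_Normal_Form.Spectral_Radius" Complex_Main
begin

text \<open>Words over the digit alphabet \<open>{0, \<dots>, b - 1}\<close> are lists of natural numbers.\<close>

definition digit_words :: "nat \<Rightarrow> nat \<Rightarrow> nat list set" where
  "digit_words b n = {w. length w = n \<and> set w \<subseteq> {..<b}}"

definition avoid_edge :: "nat list \<Rightarrow> nat list \<Rightarrow> nat list \<Rightarrow> bool" where
  "avoid_edge d u v \<longleftrightarrow> tl u = butlast v \<and> u @ [last v] \<noteq> d"

text \<open>
  \<^const>\<open>List.n_lists\<close> lists every word of length \<open>m - 1\<close> exactly once. The order of the
  vertices is immaterial, as long as it is the same for all \<open>d\<close>.
\<close>

definition vertex_list :: "nat \<Rightarrow> nat \<Rightarrow> nat list list" where
  "vertex_list b m = List.n_lists (m - 1) [0..<b]"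

lemma set_vertex_list: "set (vertex_list b m) = digit_words b (m - 1)"
  by (auto simp: vertex_list_def digit_words_def set_n_lists)

lemma distinct_vertex_list: "distinct (vertex_list b m)"
  by (simp add: vertex_list_def distinct_n_lists)

lemma length_vertex_list: "length (vertex_list b m) = b ^ (m - 1)"
  by (simp add: vertex_list_def length_n_lists)

definition adj_matrix :: "nat \<Rightarrow> nat \<Rightarrow> nat list \<Rightarrow> real mat" where
  "adj_matrix b m d = mat (b ^ (m - 1)) (b ^ (m - 1))
     (\<lambda>(i, j). if avoid_edge d (vertex_list b m ! i) (vertex_list b m ! j) then 1 else 0)"

definition adj_matrices :: "nat \<Rightarrow> nat \<Rightarrow> real mat set" where
  "adj_matrices b m = adj_matrix b m ` digit_words b m"

definition real_spectral_radius :: "real mat \<Rightarrow> real" where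
  "real_spectral_radius M = spectral_radius (map_mat complex_of_real M)"

definition entry_norm :: "real mat \<Rightarrow> real" where
  "entry_norm M = (\<Sum>i<dim_row M. \<Sum>j<dim_col M. \<bar>M $$ (i, j)\<bar>)"

definition mat_prod :: "nat \<Rightarrow> real mat list \<Rightarrow> real mat" where
  "mat_prod k Ms = foldr (*) Ms (1\<^sub>m k)"

text \<open>
  In the next two definitions \<open>S\<close> is meant to be a finite nonempty set of \<open>k \<times> k\<close>
  matrices; a tuple of indices is represented by the list of the matrices it selects.
\<close>

definition joint_spectral_radius :: "nat \<Rightarrow> real mat set \<Rightarrow> real" where
  "joint_spectral_radius k S =
     lim (\<lambda>n. SUP Ms\<in>{Ms. length Ms = n \<and> set Ms \<subseteq> S}. root n (entry_norm (mat_prod k Ms)))"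

definition finiteness_property :: "nat \<Rightarrow> real mat set \<Rightarrow> bool" where
  "finiteness_property k S \<longleftrightarrow>
     (\<exists>n\<ge>1. \<exists>Ms. length Ms = n \<and> set Ms \<subseteq> S \<and>
        joint_spectral_radius k S = root n (real_spectral_radius (mat_prod k Ms)))"

definition periodic_seq :: "'a list \<Rightarrow> nat \<Rightarrow> 'a" where
  "periodic_seq ws = (\<lambda>k. ws ! (k mod length ws))"

definition progressively_overlapping :: "(nat \<Rightarrow> nat list) \<Rightarrow> bool" where
  "progressively_overlapping \<omega> \<longleftrightarrow> (\<forall>i\<ge>1. butlast (\<omega> i) = tl (\<omega> (i - 1)))"

definition is_minimal_poly :: "complex \<Rightarrow> rat poly \<Rightarrow> bool" where
  "is_minimal_poly x p \<longleftrightarrow> lead_coeff p = 1 \<and> poly (map_poly of_rat p) x = 0 \<and>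
     (\<forall>q. q \<noteq> 0 \<and> poly (map_poly of_rat q) x = 0 \<longrightarrow> degree p \<le> degree q)"

definition algebraic_conjugate :: "complex \<Rightarrow> complex \<Rightarrow> bool" where
  "algebraic_conjugate x z \<longleftrightarrow> (\<exists>p. is_minimal_poly x p \<and> poly (map_poly of_rat p) z = 0)"

definition pisot_number :: "real \<Rightarrow> bool" where
  "pisot_number x \<longleftrightarrow> algebraic_int x \<and> x > 1 \<and>
     (\<forall>z. algebraic_conjugate (complex_of_real x) z \<and> z \<noteq> complex_of_real x \<longrightarrow> norm z < 1)"

end

theory Submission
  imports Defs "HOL-Library.Sublist"
begin

text \<open>
  The entries of the product of the matrices of \<open>d\<^sub>0, \<dots>, d\<^sub>k\<close> sum to the number of words of length
  \<open>k + m\<close> whose window of length \<open>m\<close> at position \<open>i\<close> differs from \<open>d\<^sub>i\<close> for all \<open>i \<le> k\<close>. Splitting such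
  words at their first mismatch with \<open>d\<^sub>0\<close> bounds their number by \<open>b - 1\<close> times the sum of the \<open>m\<close>
  counts for shorter words, hence by a constant times \<open>\<lambda>\<close> to the power \<open>k + 1\<close>, whatever the \<open>d\<^sub>i\<close> are.
  If the \<open>d\<^sub>i\<close> overlap progressively, the matrices carry positive vectors into each other with factor
  \<open>\<lambda>\<close>, so a period of length \<open>n\<close> has a positive eigenvector with eigenvalue \<open>\<lambda>\<close> to the power \<open>n\<close>; a
  constant word \<open>d\<close> gives the lower bound for the joint spectral radius. The conjugates of \<open>\<lambda>\<close> are
  controlled by the equality case of the triangle inequality.
\<close>

subsection \<open>Counting words that avoid moving windows\<close>

text \<open>The constraint at index \<open>i\<close> is tested on the word without its first
  \<open>i\<close> letters. A constraint longer than what remains holds vacuously, since a longer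
  list is never a prefix.\<close>

fun avoids :: "'a list list \<Rightarrow> 'a list \<Rightarrow> bool" where
  "avoids [] w \<longleftrightarrow> True"
| "avoids (d # ds) w \<longleftrightarrow> \<not> prefix d w \<and> avoids ds (tl w)"

definition avoiding_words :: "nat \<Rightarrow> nat \<Rightarrow> nat list list \<Rightarrow> nat list set" where
  "avoiding_words b n ds = {w \<in> digit_words b n. avoids ds w}"

lemma digit_words_eq: "digit_words b n = {w. set w \<subseteq> {..<b} \<and> length w = n}"
  by (auto simp: digit_words_def)

lemma finite_digit_words [simp]: "finite (digit_words b n)"
  by (simp add: digit_words_eq finite_lists_length_eq)

lemma card_digit_words: "card (digit_words b n) = b ^ n"
  by (simp add: digit_words_eq card_lists_length_eq)

lemma finite_avoiding_words [simp]: "finite (avoiding_words b n ds)"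
  by (simp add: avoiding_words_def)

lemma card_avoiding_words_le: "card (avoiding_words b n ds) \<le> b ^ n"
  by (metis (no_types, lifting) avoiding_words_def card_digit_words card_mono
      finite_digit_words mem_Collect_eq subsetI)

lemma avoids_drop: "avoids ds w \<Longrightarrow> avoids (drop i ds) (drop i w)"
proof (induction ds arbitrary: i w)
  case (Cons d ds)
  then show ?case
    by (cases i) (auto simp: drop_Suc)
qed auto

text \<open>
  A word avoiding \<open>d\<close> at the origin is determined by the position \<open>i\<close> of its first mismatch
  with \<open>d\<close>, the letter found there, and the rest, which avoids the later constraints.
\<close>

lemma card_avoiding_words_Cons_le:
  assumes d: "d \<in> digit_words b m" and n: "m \<le> n"
  shows "card (avoiding_words b n (d # ds)) \<le>
    (b - 1) * (\<Sum>i<m. card (avoiding_words b (n - Suc i) (drop i ds)))"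
proof -
  let ?W = "avoiding_words b n (d # ds)"
  let ?T = "SIGMA i:{..<m}. ({..<b} - {d ! i}) \<times> avoiding_words b (n - Suc i) (drop i ds)"
  define pos where "pos w = (LEAST i. w ! i \<noteq> d ! i)" for w
  define F where "F w = (pos w, w ! pos w, drop (Suc (pos w)) w)" for w
  have len: "length d = m" "set d \<subseteq> {..<b}"
    using d by (auto simp: digit_words_def)
  have pos: "pos w < m" "w ! pos w \<noteq> d ! pos w" "take (pos w) w = take (pos w) d"
    if w: "w \<in> ?W" for w
  proof -
    have lw: "length w = n" and np: "\<not> prefix d w"
      using w by (auto simp: avoiding_words_def digit_words_def)
    have "\<exists>i<m. w ! i \<noteq> d ! i"
    proof (rule ccontr)
      assume "\<not> ?thesis"
      then have "take m w = d"
        using len lw n by (intro nth_equalityI) auto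
      then show False
        using np take_is_prefix by metis
    qed
    then obtain i where i: "i < m" "w ! i \<noteq> d ! i" by auto
    have "pos w \<le> i"
      unfolding pos_def by (rule Least_le) (rule i)
    with i show "pos w < m" by simp
    show "w ! pos w \<noteq> d ! pos w"
      unfolding pos_def by (rule LeastI) (rule i)
    have "w ! j = d ! j" if "j < pos w" for j
      using not_less_Least[of j "\<lambda>i. w ! i \<noteq> d ! i"] that unfolding pos_def by blast
    then show "take (pos w) w = take (pos w) d"
      using \<open>pos w < m\<close> len lw n by (intro nth_equalityI) auto
  qed
  have "inj_on F ?W"
  proof (rule inj_onI)
    fix v w assume v: "v \<in> ?W" and w: "w \<in> ?W" and eq: "F v = F w"
    have l: "length v = n" "length w = n"
      using v w by (auto simp: avoiding_words_def digit_words_def)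
    have p: "pos v = pos w" "v ! pos w = w ! pos w" "drop (Suc (pos w)) v = drop (Suc (pos w)) w"
      using eq by (auto simp: F_def)
    have t: "take (pos w) v = take (pos w) w"
      using pos(3)[OF v] pos(3)[OF w] p by simp
    show "v = w"
      using id_take_nth_drop[of "pos w" v] id_take_nth_drop[of "pos w" w] pos(1)[OF w] l n p t
      by simp
  qed
  moreover have "F ` ?W \<subseteq> ?T"
  proof
    fix x assume "x \<in> F ` ?W"
    then obtain w where w: "w \<in> ?W" and x: "x = F w" by auto
    have lw: "length w = n" "set w \<subseteq> {..<b}" and av: "avoids ds (tl w)"
      using w by (auto simp: avoiding_words_def digit_words_def)
    have "w ! pos w \<in> {..<b}"
      using lw(2) nth_mem[of "pos w" w] pos(1)[OF w] lw(1) n by fastforce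
    moreover have "drop (Suc (pos w)) w \<in> avoiding_words b (n - Suc (pos w)) (drop (pos w) ds)"
      using avoids_drop[OF av, of "pos w"] lw set_drop_subset[of "Suc (pos w)" w]
      by (auto simp: avoiding_words_def digit_words_def drop_Suc)
    ultimately show "x \<in> ?T"
      using pos[OF w] by (auto simp: x F_def)
  qed
  ultimately have "card ?W \<le> card ?T"
    by (intro card_inj_on_le) auto
  also have "card ?T = (\<Sum>i<m. (b - 1) * card (avoiding_words b (n - Suc i) (drop i ds)))"
  proof -
    have "card ({..<b} - {d ! i}) = b - 1" if "i < m" for i
    proof -
      have "d ! i \<in> {..<b}"
        using len that nth_mem[of i d] by blast
      then show ?thesis by simp
    qed
    then show ?thesis
      by (subst card_SigmaI) (auto simp: card_cartesian_product)
  qed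
  finally show ?thesis
    by (simp add: sum_distrib_left)
qed

text \<open>The equation for \<beta> makes the right-hand side an exact solution of the preceding
  recursive bound, so strong induction on \<open>n\<close> applies; \<open>b ^ m\<close> absorbs the
  lengths below \<open>m\<close>. The condition \<open>n < m + length ds\<close> guarantees a
  constraint at the origin once \<open>n\<close> reaches \<open>m\<close>, and it is inherited by
  the shorter words with their shortened lists.\<close>

lemma card_avoiding_words_le_power:
  fixes \<beta> :: real
  assumes b: "b \<ge> 1" and \<beta>: "\<beta> \<ge> 1" "\<beta> ^ m = (real b - 1) * (\<Sum>k<m. \<beta> ^ k)"
  shows "set ds \<subseteq> digit_words b m \<Longrightarrow> n < m + length ds \<Longrightarrow>
    card (avoiding_words b n ds) \<le> real b ^ m * \<beta> ^ n"
proof (induction n arbitrary: ds rule: less_induct)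
  case (less n)
  show ?case
  proof (cases "n < m")
    case True
    have "real (card (avoiding_words b n ds)) \<le> real b ^ n"
      using card_avoiding_words_le[of b n ds] by (metis of_nat_mono of_nat_power)
    also have "\<dots> \<le> real b ^ m * 1"
      using True b by (simp add: power_increasing)
    also have "\<dots> \<le> real b ^ m * \<beta> ^ n"
      using \<beta> by (intro mult_left_mono) auto
    finally show ?thesis .
  next
    case False
    with less.prems obtain d ds' where ds: "ds = d # ds'"
      by (cases ds) auto
    have IH: "card (avoiding_words b (n - Suc i) (drop i ds')) \<le> real b ^ m * \<beta> ^ (n - Suc i)"
      if "i < m" for i
      using less.prems False that ds
      by (intro less.IH) (auto dest: in_set_dropD)
    have "real (card (avoiding_words b n ds)) \<le>
        real ((b - 1) * (\<Sum>i<m. card (avoiding_words b (n - Suc i) (drop i ds'))))"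
      unfolding ds using less.prems False ds
      by (intro of_nat_mono card_avoiding_words_Cons_le) auto
    also have "\<dots> \<le> (real b - 1) * (\<Sum>i<m. real b ^ m * \<beta> ^ (n - Suc i))"
      using IH b by (auto simp: of_nat_diff intro!: mult_left_mono sum_mono)
    \<comment> \<open>Pulling out \<open>\<beta> ^ (n - m)\<close> leaves the powers of \<beta>
      below \<open>m\<close> in reverse order, which the equation for \<beta> collapses.\<close>
    also have "(\<Sum>i<m. real b ^ m * \<beta> ^ (n - Suc i)) =
        (\<Sum>i<m. real b ^ m * \<beta> ^ (n - m) * \<beta> ^ (m - Suc i))"
      using False by (intro sum.cong) (auto simp: mult.assoc simp flip: power_add)
    also have "\<dots> = real b ^ m * \<beta> ^ (n - m) * (\<Sum>k<m. \<beta> ^ k)"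
      by (simp add: sum_distrib_left sum.nat_diff_reindex[of "\<lambda>k. _ * \<beta> ^ k"])
    also have "(real b - 1) * \<dots> = real b ^ m * (\<beta> ^ (n - m) * \<beta> ^ m)"
      unfolding \<beta>(2) by simp
    also have "\<beta> ^ (n - m) * \<beta> ^ m = \<beta> ^ n"
      using False by (simp flip: power_add)
    finally show ?thesis .
  qed
qed

text \<open>The adjacency matrix of \<open>d\<close> as an operator on functions of vertices, free
  of any numbering of them. The letter \<open>a\<close> stands for the edge from \<open>u\<close> to
  \<open>tl u @ [a]\<close>.\<close>

definition avoid_step :: "nat \<Rightarrow> nat list \<Rightarrow> (nat list \<Rightarrow> real) \<Rightarrow> nat list \<Rightarrow> real" where
  "avoid_step b d f u = (\<Sum>a\<in>{a. a < b \<and> u @ [a] \<noteq> d}. f (tl u @ [a]))"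

text \<open>Iterating the operators on the constant \<open>1\<close> counts walks from
  \<open>u\<close>. Each step appends a letter, so a walk is a word \<open>u @ w\<close>, and the
  edge used at step \<open>i\<close> is its window of length \<open>m\<close> at position
  \<open>i\<close>. As in a matrix product, the head of the list governs the first edge.\<close>

lemma foldr_avoid_step_eq_card:
  assumes "m \<ge> 2" and "u \<in> digit_words b (m - 1)" and "set ds \<subseteq> digit_words b m"
  shows "foldr (avoid_step b) ds (\<lambda>_. 1) u =
    card {w \<in> digit_words b (length ds). avoids ds (u @ w)}"
  using assms(2,3)
proof (induction ds arbitrary: u)
  case Nil
  have "{w \<in> digit_words b 0. avoids [] (u @ w)} = {[]}"
    by (auto simp: digit_words_def)
  then show ?case by simp
next
  case (Cons d ds)
  let ?A = "{a. a < b \<and> u @ [a] \<noteq> d}"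
  let ?B = "\<lambda>a. {w \<in> digit_words b (length ds). avoids ds ((tl u @ [a]) @ w)}"
  have u: "length u = m - 1" "set u \<subseteq> {..<b}" "u \<noteq> []"
    using Cons.prems assms(1) by (auto simp: digit_words_def)
  have d: "length d = m"
    using Cons.prems by (auto simp: digit_words_def)
  have pre: "prefix d (u @ a # w) \<longleftrightarrow> u @ [a] = d" for a w
  proof -
    have "prefix d (u @ a # w) \<longleftrightarrow> (\<exists>zs. (u @ [a]) @ w = d @ zs)"
      by (simp add: prefix_def)
    also have "\<dots> \<longleftrightarrow> u @ [a] = d"
      using u d assms(1) by (subst append_eq_append_conv) auto
    finally show ?thesis .
  qed
  \<comment> \<open>Splitting off the first letter \<open>a\<close> of \<open>w\<close> leaves a
    walk from \<open>tl u @ [a]\<close>, because \<open>u\<close> is nonempty.\<close>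
  have "{w \<in> digit_words b (length (d # ds)). avoids (d # ds) (u @ w)} =
      (\<lambda>(a, w). a # w) ` (SIGMA a:?A. ?B a)"
    using u(3) by (auto simp: digit_words_def length_Suc_conv image_iff pre)
  then have "card {w \<in> digit_words b (length (d # ds)). avoids (d # ds) (u @ w)} =
      card (SIGMA a:?A. ?B a)"
    by (simp add: card_image inj_on_def)
  also have "\<dots> = (\<Sum>a\<in>?A. card (?B a))"
    by simp
  also have "real \<dots> = (\<Sum>a\<in>?A. foldr (avoid_step b) ds (\<lambda>_. 1) (tl u @ [a]))"
  proof (unfold of_nat_sum, intro sum.cong refl)
    fix a assume "a \<in> ?A"
    then have "tl u @ [a] \<in> digit_words b (m - 1)"
      using u assms(1) by (auto simp: digit_words_def dest: list.set_sel(2))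
    then show "real (card (?B a)) = foldr (avoid_step b) ds (\<lambda>_. 1) (tl u @ [a])"
      using Cons.IH[of "tl u @ [a]"] Cons.prems by simp
  qed
  finally show ?case
    by (simp add: avoid_step_def)
qed

lemma sum_foldr_avoid_step_eq_card:
  assumes "m \<ge> 2" and "set ds \<subseteq> digit_words b m"
  shows "(\<Sum>u\<in>digit_words b (m - 1). foldr (avoid_step b) ds (\<lambda>_. 1) u) =
    card (avoiding_words b (m - 1 + length ds) ds)"
proof -
  let ?B = "\<lambda>u. {w \<in> digit_words b (length ds). avoids ds (u @ w)}"
  have "w \<in> (\<lambda>(u, w). u @ w) ` (SIGMA u:digit_words b (m - 1). ?B u)"
    if "w \<in> avoiding_words b (m - 1 + length ds) ds" for w
    using that set_take_subset[of "m - 1" w] set_drop_subset[of "m - 1" w]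
    by (intro image_eqI[of _ _ "(take (m - 1) w, drop (m - 1) w)"])
      (auto simp: avoiding_words_def digit_words_def)
  then have "avoiding_words b (m - 1 + length ds) ds =
      (\<lambda>(u, w). u @ w) ` (SIGMA u:digit_words b (m - 1). ?B u)"
    by (auto simp: avoiding_words_def digit_words_def)
  moreover have "inj_on (\<lambda>(u, w). u @ w) (SIGMA u:digit_words b (m - 1). ?B u)"
    by (auto simp: inj_on_def digit_words_def)
  ultimately have "card (avoiding_words b (m - 1 + length ds) ds) =
      card (SIGMA u:digit_words b (m - 1). ?B u)"
    by (simp add: card_image)
  then show ?thesis
    using assms by (simp add: foldr_avoid_step_eq_card)
qed

section \<open>Positive functions that the operators rescale by \<beta>\<close>

text \<open>
  If \<open>l\<close> is the length of the longest common suffix of \<open>p\<close> and \<open>u\<close>, this is the sum \<open>H l\<close> of the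
  first \<open>m - l\<close> powers of \<open>1 / \<beta>\<close>. It solves \<open>\<beta> * H l = (b - 1) * H 0 + H (l + 1)\<close> with \<open>H m = 0\<close>:
  a mismatching letter resets \<open>l\<close> to \<open>0\<close>, a matching one increases it, and \<open>m\<close> matches are forbidden.
\<close>

definition mismatch_weight :: "nat \<Rightarrow> real \<Rightarrow> nat list \<Rightarrow> nat list \<Rightarrow> real" where
  "mismatch_weight m \<beta> p u =
     1 + (\<Sum>i<m - 1. if drop i u \<noteq> drop i p then (1 / \<beta>) ^ Suc i else 0)"

lemma mismatch_weight_pos: "\<beta> > 0 \<Longrightarrow> mismatch_weight m \<beta> p u > 0"
  unfolding mismatch_weight_def by (intro add_pos_nonneg sum_nonneg) auto

text \<open>Appending a letter shifts the window by one, so agreement with suffixes of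
  \<open>butlast d\<close> turns into agreement with suffixes of \<open>tl d\<close>. Of the
  appended letters, the \<open>b - 1\<close> that differ from the last letter \<open>c\<close> of
  \<open>d\<close> destroy all agreement; \<open>c\<close> itself prolongs it, or is forbidden if
  \<open>u\<close> is \<open>butlast d\<close>.\<close>

lemma avoid_step_mismatch_weight:
  assumes b: "b \<ge> 1" and m: "m \<ge> 2" and d: "d \<in> digit_words b m"
    and \<beta>: "\<beta> > 0" "\<beta> ^ m = (real b - 1) * (\<Sum>k<m. \<beta> ^ k)"
    and u: "u \<in> digit_words b (m - 1)"
  shows "avoid_step b d (mismatch_weight m \<beta> (tl d)) u = \<beta> * mismatch_weight m \<beta> (butlast d) u"
proof -
  obtain p c where dp: "d = p @ [c]"
    using d m by (cases d rule: rev_cases) (auto simp: digit_words_def)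
  have lp: "length p = m - 1" "length u = m - 1" "c < b" "p \<noteq> []" "u \<noteq> []"
    using d u m by (auto simp: digit_words_def dp)
  obtain k where k: "m - 1 = Suc k"
    using m by (cases "m - 1") auto
  let ?w = "mismatch_weight m \<beta> (tl d)"
  have far: "?w (tl u @ [a]) = (\<Sum>j<m. (1 / \<beta>) ^ j)" if "a \<noteq> c" for a
  proof -
    have "drop i (tl u @ [a]) \<noteq> drop i (tl d)" if "i < m - 1" for i
      using that lp \<open>a \<noteq> c\<close> by (auto simp: dp)
    then have "?w (tl u @ [a]) = 1 + (\<Sum>i<m - 1. (1 / \<beta>) ^ Suc i)"
      unfolding mismatch_weight_def by auto
    also have "\<dots> = (\<Sum>j<Suc (m - 1). (1 / \<beta>) ^ j)"
      by (subst sum.lessThan_Suc_shift) simp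
    finally show ?thesis using m by simp
  qed
  have "(1 / \<beta>) ^ j * \<beta> ^ m = \<beta> * \<beta> ^ (m - Suc j)" if "j < m" for j
  proof -
    have "\<beta> ^ m = \<beta> ^ j * \<beta> ^ Suc (m - Suc j)"
      using that by (simp only: flip: power_add) simp
    then show ?thesis
      using \<beta>(1) by (simp add: power_one_over)
  qed
  then have "(\<Sum>j<m. (1 / \<beta>) ^ j) * \<beta> ^ m = \<beta> * (\<Sum>j<m. \<beta> ^ (m - Suc j))"
    by (simp add: sum_distrib_left sum_distrib_right del: power_one_over)
  also have "\<dots> = \<beta> * (\<Sum>k<m. \<beta> ^ k)"
    by (simp add: sum.nat_diff_reindex)
  finally have "(real b - 1) * (\<Sum>j<m. (1 / \<beta>) ^ j) * \<beta> ^ m = \<beta> * \<beta> ^ m"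
    using \<beta>(2) by (simp add: mult_ac)
  \<comment> \<open>The equation for \<beta> divided by \<open>\<beta> ^ (m - 1)\<close>: the
    mismatching letters together contribute exactly \<beta>.\<close>
  then have tot: "(real b - 1) * (\<Sum>j<m. (1 / \<beta>) ^ j) = \<beta>"
    using \<beta>(1) by simp
  \<comment> \<open>Multiplying by \<beta> lowers every exponent by one. The comparison of
    \<open>u\<close> with all of \<open>p\<close> becomes the leading \<open>1\<close> of the new
    weight; the others match after a shift of the suffixes.\<close>
  have near: "\<beta> * mismatch_weight m \<beta> p u = \<beta> + (if u \<noteq> p then ?w (tl u @ [c]) else 0)"
  proof -
    have "?w (tl u @ [c]) = 1 + (\<Sum>i<k. if drop (Suc i) u \<noteq> drop (Suc i) p
        then (1 / \<beta>) ^ Suc i else 0)"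
      using lp k by (auto simp: mismatch_weight_def dp drop_Suc intro!: sum.cong)
    moreover have "\<beta> * mismatch_weight m \<beta> p u = \<beta> + (if u \<noteq> p then 1 else 0) +
        (\<Sum>i<k. if drop (Suc i) u \<noteq> drop (Suc i) p then (1 / \<beta>) ^ Suc i else 0)"
      unfolding mismatch_weight_def k using \<beta>(1)
      by (subst sum.lessThan_Suc_shift)
        (auto simp: distrib_left sum_distrib_left if_distrib[of "(*) \<beta>"] cong: if_cong intro!: sum.cong)
    ultimately show ?thesis by auto
  qed
  have split: "{a. a < b \<and> u @ [a] \<noteq> d} = ({..<b} - {c}) \<union> (if u \<noteq> p then {c} else {})"
    using lp by (auto simp: dp)
  have "(\<Sum>a\<in>{..<b} - {c}. ?w (tl u @ [a])) = (\<Sum>a\<in>{..<b} - {c}. \<Sum>j<m. (1 / \<beta>) ^ j)"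
    using far by (intro sum.cong) auto
  also have "\<dots> = \<beta>"
    using tot lp b by (simp add: of_nat_diff)
  finally show ?thesis
    using near unfolding avoid_step_def split by (auto simp: dp sum.union_disjoint)
qed

lemma avoid_step_cong:
  assumes "m \<ge> 2" "u \<in> digit_words b (m - 1)"
    and "\<And>v. v \<in> digit_words b (m - 1) \<Longrightarrow> f v = g v"
  shows "avoid_step b d f u = avoid_step b d g u"
  using assms unfolding avoid_step_def
  by (intro sum.cong refl assms(3)) (auto simp: digit_words_def dest: list.set_sel(2)[rotated])

lemma avoid_step_scale: "avoid_step b d (\<lambda>v. r * f v) u = r * avoid_step b d f u"
  by (simp add: avoid_step_def sum_distrib_left)

text \<open>The last operator acts first. The overlap \<open>butlast y = tl x\<close> makes the
  weight produced by \<open>y\<close> the one consumed by \<open>x\<close>, so each step contributes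
  one factor \<beta>.\<close>

lemma foldr_avoid_step_mismatch_weight:
  assumes b: "b \<ge> 1" and m: "m \<ge> 2"
    and \<beta>: "\<beta> > 0" "\<beta> ^ m = (real b - 1) * (\<Sum>k<m. \<beta> ^ k)"
    and "set ds \<subseteq> digit_words b m" "ds \<noteq> []" "successively (\<lambda>x y. butlast y = tl x) ds"
    and "u \<in> digit_words b (m - 1)"
  shows "foldr (avoid_step b) ds (mismatch_weight m \<beta> (tl (last ds))) u =
    \<beta> ^ length ds * mismatch_weight m \<beta> (butlast (hd ds)) u"
  using assms(5-)
proof (induction ds arbitrary: u)
  case (Cons d ds)
  show ?case
  proof (cases "ds = []")
    case True
    then show ?thesis
      using Cons.prems avoid_step_mismatch_weight[OF b m _ \<beta>] by simp
  next
    case False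
    have succ: "successively (\<lambda>x y. butlast y = tl x) ds" "butlast (hd ds) = tl d"
      using Cons.prems False by (auto simp: successively_Cons)
    have "foldr (avoid_step b) (d # ds) (mismatch_weight m \<beta> (tl (last (d # ds)))) u =
        avoid_step b d (\<lambda>v. \<beta> ^ length ds * mismatch_weight m \<beta> (tl d) v) u"
      using Cons.IH[OF _ False succ(1)] Cons.prems False succ(2) m
      by (auto intro!: avoid_step_cong[where m = m])
    then show ?thesis
      using Cons.prems avoid_step_mismatch_weight[OF b m _ \<beta>]
      by (simp add: avoid_step_scale)
  qed
qed simp

subsection \<open>Spectral radii\<close>

text \<open>Upper Collatz-Wielandt bound: the eigenvalue equation is read in the row
  \<open>i\<close> where \<open>norm (v $ i) / h i\<close> is largest.\<close>

lemma real_spectral_radius_le: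
  fixes M :: "real mat" and h :: "nat \<Rightarrow> real"
  assumes M: "M \<in> carrier_mat n n" and n: "n > 0"
    and h: "\<And>i. i < n \<Longrightarrow> h i > 0"
    and le: "\<And>i. i < n \<Longrightarrow> (\<Sum>j<n. \<bar>M $$ (i, j)\<bar> * h j) \<le> r * h i"
  shows "real_spectral_radius M \<le> r"
proof -
  let ?C = "map_mat complex_of_real M"
  have C: "?C \<in> carrier_mat n n"
    using M by simp
  obtain \<mu> where \<mu>: "eigenvalue ?C \<mu>" "spectral_radius ?C = norm \<mu>"
    using spectral_radius_mem_max(1)[OF C n] by (auto simp: spectrum_def)
  then obtain v where v: "v \<in> carrier_vec n" "v \<noteq> 0\<^sub>v n" "?C *\<^sub>v v = \<mu> \<cdot>\<^sub>v v"
    using C unfolding eigenvalue_def eigenvector_def by auto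
  define q where "q j = norm (v $ j) / h j" for j
  obtain i where i: "i < n" "\<And>j. j < n \<Longrightarrow> q j \<le> q i"
  proof -
    have "Max (q ` {..<n}) \<in> q ` {..<n}"
      using n by (intro Max_in) auto
    then obtain i where "i < n" "q i = Max (q ` {..<n})" by auto
    then show ?thesis
      by (intro that[of i]) auto
  qed
  have qh: "norm (v $ j) = q j * h j" if "j < n" for j
    using h[OF that] by (simp add: q_def)
  obtain j where "j < n" "v $ j \<noteq> 0"
    using v(1,2) by (metis carrier_vecD eq_vecI index_zero_vec)
  then have "q j > 0"
    using h by (simp add: q_def)
  then have qi: "q i > 0"
    using i(2)[OF \<open>j < n\<close>] by linarith
  have "\<mu> * v $ i = (\<Sum>j<n. complex_of_real (M $$ (i, j)) * v $ j)"
    using arg_cong[OF v(3), of "\<lambda>w. w $ i"] i(1) M v(1)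
    by (simp add: scalar_prod_def atLeast0LessThan)
  then have "norm \<mu> * norm (v $ i) = norm (\<Sum>j<n. complex_of_real (M $$ (i, j)) * v $ j)"
    by (metis norm_mult)
  also have "\<dots> \<le> (\<Sum>j<n. \<bar>M $$ (i, j)\<bar> * norm (v $ j))"
    by (rule sum_norm_le) (simp add: norm_mult)
  also have "\<dots> \<le> (\<Sum>j<n. q i * (\<bar>M $$ (i, j)\<bar> * h j))"
  proof (rule sum_mono)
    fix j assume "j \<in> {..<n}"
    then have "norm (v $ j) \<le> q i * h j"
      using qh[of j] i(2)[of j] h[of j] by (auto intro!: mult_right_mono)
    then have "\<bar>M $$ (i, j)\<bar> * norm (v $ j) \<le> \<bar>M $$ (i, j)\<bar> * (q i * h j)"
      by (rule mult_left_mono) simp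
    then show "\<bar>M $$ (i, j)\<bar> * norm (v $ j) \<le> q i * (\<bar>M $$ (i, j)\<bar> * h j)"
      by (simp add: mult_ac)
  qed
  also have "\<dots> \<le> q i * (r * h i)"
    unfolding sum_distrib_left[symmetric] using le[OF i(1)] qi by (intro mult_left_mono) auto
  also have "\<dots> = r * norm (v $ i)"
    using qh[OF i(1)] by simp
  finally have "norm \<mu> \<le> r"
    using qi h[OF i(1)] qh[OF i(1)] by (simp add: mult_le_cancel_right)
  then show ?thesis
    by (simp add: real_spectral_radius_def \<mu>(2))
qed

text \<open>Turns a known eigenvalue of a product into a lower bound for its norm.\<close>

lemma real_spectral_radius_le_entry_norm:
  assumes M: "M \<in> carrier_mat n n" and n: "n > 0"
  shows "real_spectral_radius M \<le> entry_norm M"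
proof (rule real_spectral_radius_le[OF M n, of "\<lambda>_. 1"])
  fix i assume "i < n"
  then have "(\<Sum>j<n. \<bar>M $$ (i, j)\<bar>) \<le> (\<Sum>i<n. \<Sum>j<n. \<bar>M $$ (i, j)\<bar>)"
    by (intro member_le_sum) (auto intro: sum_nonneg)
  then show "(\<Sum>j<n. \<bar>M $$ (i, j)\<bar> * 1) \<le> entry_norm M * 1"
    using M by (simp add: entry_norm_def)
qed simp

text \<open>The elementary part of Perron-Frobenius: with \<open>v\<close> as weights the row bound
  is an equality, which gives the upper estimate, and the complex image of \<open>v\<close> exhibits
  \<open>r\<close> as an eigenvalue.\<close>

lemma real_spectral_radius_eq_positive_eigenvector:
  assumes M: "M \<in> carrier_mat n n" and n: "n > 0"
    and nonneg: "\<And>i j. i < n \<Longrightarrow> j < n \<Longrightarrow> M $$ (i, j) \<ge> 0"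
    and v: "v \<in> carrier_vec n" "\<And>i. i < n \<Longrightarrow> v $ i > 0" "M *\<^sub>v v = r \<cdot>\<^sub>v v" and r: "r \<ge> 0"
  shows "real_spectral_radius M = r"
proof (rule antisym)
  have row: "(\<Sum>j<n. M $$ (i, j) * v $ j) = r * v $ i" if "i < n" for i
    using arg_cong[OF v(3), of "\<lambda>w. w $ i"] that M v(1)
    by (simp add: scalar_prod_def atLeast0LessThan)
  show "real_spectral_radius M \<le> r"
    using real_spectral_radius_le[OF M n, of "\<lambda>i. v $ i" r] v(2) row nonneg by simp
  let ?C = "map_mat complex_of_real M" and ?v = "map_vec complex_of_real v"
  have C: "?C \<in> carrier_mat n n"
    using M by simp
  have "?C *\<^sub>v ?v = of_real r \<cdot>\<^sub>v ?v"
    using arg_cong[OF row, of _ complex_of_real] M v(1)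
    by (intro eq_vecI) (auto simp: scalar_prod_def atLeast0LessThan)
  moreover have "?v \<noteq> 0\<^sub>v n"
  proof
    assume "?v = 0\<^sub>v n"
    then have "?v $ 0 = 0" using n by simp
    then show False
      using v(1) v(2)[OF n] n by simp
  qed
  ultimately have "eigenvalue ?C (of_real r)"
    unfolding eigenvalue_def eigenvector_def using M v(1) by (intro exI[of _ ?v]) auto
  then have "norm (complex_of_real r) \<le> spectral_radius ?C"
    unfolding spectrum_def by (intro spectral_radius_mem_max(2)[OF C n, unfolded spectrum_def] imageI) simp
  then show "r \<le> real_spectral_radius M"
    using r by (simp add: real_spectral_radius_def)
qed

section \<open>Products of adjacency matrices acting on functions of words\<close>

lemma mat_prod_carrier:
  "set Ms \<subseteq> carrier_mat k k \<Longrightarrow> mat_prod k Ms \<in> carrier_mat k k"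
  by (induction Ms) (auto simp: mat_prod_def)

lemma mat_prod_nonneg:
  assumes "set Ms \<subseteq> {M \<in> carrier_mat k k. \<forall>i<k. \<forall>j<k. M $$ (i, j) \<ge> 0}" "i < k" "j < k"
  shows "mat_prod k Ms $$ (i, j) \<ge> 0"
  using assms
proof (induction Ms arbitrary: i)
  case Nil
  then show ?case by (auto simp: mat_prod_def)
next
  case (Cons M Ms)
  have "mat_prod k Ms \<in> carrier_mat k k"
    using Cons.prems by (intro mat_prod_carrier) auto
  moreover have "mat_prod k (M # Ms) = M * mat_prod k Ms"
    by (simp add: mat_prod_def)
  ultimately show ?case
    using Cons by (auto simp: scalar_prod_def intro!: sum_nonneg mult_nonneg_nonneg)
qed

lemma adj_matrix_carrier [simp]: "adj_matrix b m d \<in> carrier_mat (b ^ (m - 1)) (b ^ (m - 1))"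
  by (simp add: adj_matrix_def)

lemma mat_prod_adj_matrix_nonneg:
  assumes "i < b ^ (m - 1)" "j < b ^ (m - 1)"
  shows "mat_prod (b ^ (m - 1)) (map (adj_matrix b m) ds) $$ (i, j) \<ge> 0"
  using assms by (intro mat_prod_nonneg) (auto simp: adj_matrix_def simp del: One_nat_def)

definition word_vec :: "nat \<Rightarrow> nat \<Rightarrow> (nat list \<Rightarrow> real) \<Rightarrow> real vec" where
  "word_vec b m f = vec (b ^ (m - 1)) (\<lambda>i. f (vertex_list b m ! i))"

lemma word_vec_carrier [simp]: "word_vec b m f \<in> carrier_vec (b ^ (m - 1))"
  by (simp add: word_vec_def)

lemma vertex_list_nth: "i < b ^ (m - 1) \<Longrightarrow> vertex_list b m ! i \<in> digit_words b (m - 1)"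
  by (metis length_vertex_list nth_mem set_vertex_list)

lemma sum_vertex_list:
  "(\<Sum>i<b ^ (m - 1). f (vertex_list b m ! i)) = (\<Sum>u\<in>digit_words b (m - 1). f u)"
  by (rule sum.reindex_bij_betw, rule bij_betw_nth)
    (simp_all add: distinct_vertex_list length_vertex_list set_vertex_list)

lemma adj_matrix_mult_word_vec:
  assumes m: "m \<ge> 2"
  shows "adj_matrix b m d *\<^sub>v word_vec b m f = word_vec b m (avoid_step b d f)"
proof (rule eq_vecI)
  fix i assume "i < dim_vec (word_vec b m (avoid_step b d f))"
  then have i: "i < b ^ (m - 1)"
    by (simp add: word_vec_def)
  define u where "u = vertex_list b m ! i"
  have u: "length u = m - 1" "set u \<subseteq> {..<b}" "u \<noteq> []"
    using vertex_list_nth[OF i] m by (auto simp: u_def digit_words_def)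
  have "(adj_matrix b m d *\<^sub>v word_vec b m f) $ i =
      (\<Sum>j<b ^ (m - 1). (if avoid_edge d u (vertex_list b m ! j) then 1 else 0) * f (vertex_list b m ! j))"
    using i by (simp add: adj_matrix_def word_vec_def scalar_prod_def atLeast0LessThan u_def)
  also have "\<dots> = (\<Sum>v\<in>digit_words b (m - 1). (if avoid_edge d u v then 1 else 0) * f v)"
    by (rule sum_vertex_list)
  also have "\<dots> = (\<Sum>v\<in>{v \<in> digit_words b (m - 1). avoid_edge d u v}. f v)"
    by (simp add: sum.inter_filter if_distrib[of "\<lambda>x. x * _"] cong: if_cong)
  \<comment> \<open>Out-neighbours of \<open>u\<close> are parametrised by their last letter, the
    other letters being fixed by \<open>tl u\<close>.\<close>
  also have "\<dots> = (\<Sum>a\<in>{a. a < b \<and> u @ [a] \<noteq> d}. f (tl u @ [a]))"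
  proof (rule sum.reindex_bij_witness[of _ "\<lambda>a. tl u @ [a]" last])
    fix v assume "v \<in> {v \<in> digit_words b (m - 1). avoid_edge d u v}"
    then have v: "length v = m - 1" "set v \<subseteq> {..<b}" "v \<noteq> []" "tl u = butlast v" "u @ [last v] \<noteq> d"
      using m by (auto simp: digit_words_def avoid_edge_def)
    show "tl u @ [last v] = v"
      using v by simp
    then show "f (tl u @ [last v]) = f v" by simp
    show "last v \<in> {a. a < b \<and> u @ [a] \<noteq> d}"
      using v last_in_set[of v] by blast
  next
    fix a assume "a \<in> {a. a < b \<and> u @ [a] \<noteq> d}"
    then show "tl u @ [a] \<in> {v \<in> digit_words b (m - 1). avoid_edge d u v}"
      using u m by (auto simp: digit_words_def avoid_edge_def dest: list.set_sel(2)[rotated])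
  qed auto
  finally show "(adj_matrix b m d *\<^sub>v word_vec b m f) $ i = word_vec b m (avoid_step b d f) $ i"
    using i by (simp add: word_vec_def avoid_step_def u_def)
qed (simp add: adj_matrix_def word_vec_def)

lemma mat_prod_adj_matrix_carrier:
  "mat_prod (b ^ (m - 1)) (map (adj_matrix b m) ds) \<in> carrier_mat (b ^ (m - 1)) (b ^ (m - 1))"
  by (rule mat_prod_carrier) (auto simp del: One_nat_def)

lemma mat_prod_mult_word_vec:
  assumes m: "m \<ge> 2"
  shows "mat_prod (b ^ (m - 1)) (map (adj_matrix b m) ds) *\<^sub>v word_vec b m f =
    word_vec b m (foldr (avoid_step b) ds f)"
proof (induction ds)
  case Nil
  then show ?case by (simp add: mat_prod_def del: One_nat_def)
next
  case (Cons d ds)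
  have "mat_prod (b ^ (m - 1)) (map (adj_matrix b m) (d # ds)) *\<^sub>v word_vec b m f =
      adj_matrix b m d *\<^sub>v (mat_prod (b ^ (m - 1)) (map (adj_matrix b m) ds) *\<^sub>v word_vec b m f)"
    using assoc_mult_mat_vec[OF adj_matrix_carrier mat_prod_adj_matrix_carrier word_vec_carrier]
    by (simp add: mat_prod_def)
  then show ?case
    using m by (simp add: Cons adj_matrix_mult_word_vec del: One_nat_def)
qed

text \<open>All entries are nonnegative, so the norm is the sum of the coordinates of the product
  applied to the all-ones vector, and these coordinates count walks.\<close>

lemma entry_norm_mat_prod:
  assumes m: "m \<ge> 2" and ds: "set ds \<subseteq> digit_words b m"
  shows "entry_norm (mat_prod (b ^ (m - 1)) (map (adj_matrix b m) ds)) =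
    card (avoiding_words b (m - 1 + length ds) ds)"
proof -
  let ?P = "mat_prod (b ^ (m - 1)) (map (adj_matrix b m) ds)"
  have P: "?P \<in> carrier_mat (b ^ (m - 1)) (b ^ (m - 1))"
    by (rule mat_prod_adj_matrix_carrier)
  have "entry_norm ?P = (\<Sum>i<b ^ (m - 1). \<Sum>j<b ^ (m - 1). ?P $$ (i, j))"
    using P mat_prod_adj_matrix_nonneg by (simp add: entry_norm_def)
  also have "\<dots> = (\<Sum>i<b ^ (m - 1). (?P *\<^sub>v word_vec b m (\<lambda>_. 1)) $ i)"
    using P by (intro sum.cong) (auto simp: word_vec_def scalar_prod_def atLeast0LessThan)
  also have "\<dots> = (\<Sum>i<b ^ (m - 1). foldr (avoid_step b) ds (\<lambda>_. 1) (vertex_list b m ! i))"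
    unfolding mat_prod_mult_word_vec[OF m] by (simp add: word_vec_def)
  also have "\<dots> = card (avoiding_words b (m - 1 + length ds) ds)"
    unfolding sum_vertex_list by (rule sum_foldr_avoid_step_eq_card[OF m ds])
  finally show ?thesis .
qed

section \<open>Periodic blocks and the joint spectral radius\<close>

lemma progressively_overlapping_periodicD:
  assumes "progressively_overlapping (periodic_seq ds)" and "ds \<noteq> []"
  shows "successively (\<lambda>x y. butlast y = tl x) ds" "butlast (hd ds) = tl (last ds)"
proof -
  have *: "butlast (ds ! (Suc i mod length ds)) = tl (ds ! (i mod length ds))" for i
    using assms(1)[unfolded progressively_overlapping_def, rule_format, of "Suc i"]
    by (simp add: periodic_seq_def)
  show "successively (\<lambda>x y. butlast y = tl x) ds"
    unfolding successively_conv_nth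
  proof safe
    fix i assume "Suc i < length ds"
    then show "butlast (ds ! Suc i) = tl (ds ! i)"
      using *[of i] by simp
  qed
  show "butlast (hd ds) = tl (last ds)"
    \<comment> \<open>At the last index the successor wraps around to \<open>0\<close>, which links
      the end of the block to its beginning.\<close>
    using *[of "length ds - 1"] assms(2) by (simp add: hd_conv_nth last_conv_nth)
qed

text \<open>One period returns to the initial weight, because \<open>tl (last ds)\<close> is
  \<open>butlast (hd ds)\<close>; that weight is a positive eigenvector of the product.\<close>

lemma real_spectral_radius_progressively_overlapping:
  assumes b: "b \<ge> 1" and m: "m \<ge> 2"
    and \<beta>: "\<beta> > 0" "\<beta> ^ m = (real b - 1) * (\<Sum>k<m. \<beta> ^ k)"
    and ds: "set ds \<subseteq> digit_words b m" "ds \<noteq> []"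
    and po: "progressively_overlapping (periodic_seq ds)"
  shows "real_spectral_radius (mat_prod (b ^ (m - 1)) (map (adj_matrix b m) ds)) = \<beta> ^ length ds"
proof -
  note D = progressively_overlapping_periodicD[OF po ds(2)]
  let ?P = "mat_prod (b ^ (m - 1)) (map (adj_matrix b m) ds)"
  let ?v = "word_vec b m (mismatch_weight m \<beta> (butlast (hd ds)))"
  have "?P *\<^sub>v ?v = \<beta> ^ length ds \<cdot>\<^sub>v ?v"
    unfolding mat_prod_mult_word_vec[OF m]
    using foldr_avoid_step_mismatch_weight[OF b m \<beta> ds D(1)] vertex_list_nth
    by (intro eq_vecI) (auto simp: word_vec_def D(2))
  then show ?thesis
    using b \<beta> by (intro real_spectral_radius_eq_positive_eigenvector[OF mat_prod_adj_matrix_carrier])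
      (auto simp: word_vec_def mismatch_weight_pos mat_prod_adj_matrix_nonneg simp del: One_nat_def)
qed

text \<open>For positive \<open>n\<close> the supremum lies between \<beta>, by the powers of
  \<open>M\<close>, and \<open>root n c * \<beta>\<close>, by the uniform growth bound;
  \<open>root n c\<close> tends to \<open>1\<close>.\<close>

lemma joint_spectral_radius_eq:
  fixes \<beta> c :: real
  assumes \<beta>: "\<beta> \<ge> 0" and c: "c > 0"
    and upper: "\<And>Ms. set Ms \<subseteq> S \<Longrightarrow> entry_norm (mat_prod k Ms) \<le> c * \<beta> ^ length Ms"
    and M: "M \<in> S" and lower: "\<And>n. \<beta> ^ n \<le> entry_norm (mat_prod k (replicate n M))"
  shows "joint_spectral_radius k S = \<beta>"
proof -
  let ?L = "\<lambda>n. {Ms. length Ms = n \<and> set Ms \<subseteq> S}"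
  let ?r = "\<lambda>n Ms. root n (entry_norm (mat_prod k Ms))"
  have le: "?r n Ms \<le> root n c * \<beta>" if "Ms \<in> ?L n" "n > 0" for n Ms
  proof -
    have "?r n Ms \<le> root n (c * \<beta> ^ n)"
      using that upper[of Ms] by (intro real_root_le_mono) auto
    also have "\<dots> = root n c * \<beta>"
      using that \<beta> by (simp add: real_root_mult real_root_power_cancel)
    finally show ?thesis .
  qed
  have rep: "replicate n M \<in> ?L n" for n
    using M by (auto simp: set_replicate_conv_if)
  have lo: "\<beta> \<le> (SUP Ms\<in>?L n. ?r n Ms)" if n: "n > 0" for n
  proof -
    have "\<beta> = root n (\<beta> ^ n)"
      using n \<beta> by (simp add: real_root_power_cancel)
    also have "\<dots> \<le> ?r n (replicate n M)"
      using n lower by (intro real_root_le_mono) auto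
    also have "\<dots> \<le> (SUP Ms\<in>?L n. ?r n Ms)"
    proof (rule cSUP_upper[OF rep])
      show "bdd_above (?r n ` ?L n)"
        using le[OF _ n] by (rule bdd_aboveI2)
    qed
    finally show ?thesis .
  qed
  have up: "(SUP Ms\<in>?L n. ?r n Ms) \<le> root n c * \<beta>" if n: "n > 0" for n
  proof (rule cSUP_least)
    show "?L n \<noteq> {}"
      using rep by blast
  qed (rule le[OF _ n])
  have "(\<lambda>n. SUP Ms\<in>?L n. ?r n Ms) \<longlonglongrightarrow> \<beta>"
  proof (rule real_tendsto_sandwich)
    \<comment> \<open>\<open>root 0\<close> is constantly \<open>0\<close>, so both bounds are
      claimed for positive \<open>n\<close> only.\<close>
    show "\<forall>\<^sub>F n in sequentially. \<beta> \<le> (SUP Ms\<in>?L n. ?r n Ms)"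
      using eventually_gt_at_top[of 0] by (rule eventually_mono) (rule lo)
    show "\<forall>\<^sub>F n in sequentially. (SUP Ms\<in>?L n. ?r n Ms) \<le> root n c * \<beta>"
      using eventually_gt_at_top[of 0] by (rule eventually_mono) (rule up)
    show "(\<lambda>_. \<beta>) \<longlonglongrightarrow> \<beta>"
      by (rule tendsto_const)
    show "(\<lambda>n. root n c * \<beta>) \<longlonglongrightarrow> \<beta>"
      using tendsto_mult_right[OF LIMSEQ_root_const[OF c], of \<beta>] by simp
  qed
  then show ?thesis
    unfolding joint_spectral_radius_def by (rule limI)
qed

text \<open>Provides the constant word that serves both for the lower bound and as witness of
  finiteness.\<close>

lemma progressively_overlapping_replicate:
  assumes "n \<ge> 1"
  shows "progressively_overlapping (periodic_seq (replicate n (replicate m a)))"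
proof -
  have "periodic_seq (replicate n (replicate m a)) k = replicate m a" for k
    using assms by (simp add: periodic_seq_def)
  moreover have "butlast (replicate m a) = tl (replicate m a)"
    by (simp add: butlast_conv_take)
  ultimately show ?thesis
    by (simp add: progressively_overlapping_def)
qed

lemma joint_spectral_radius_adj_matrices:
  assumes b: "b \<ge> 1" and m: "m \<ge> 2"
    and \<beta>: "\<beta> \<ge> 1" "\<beta> ^ m = (real b - 1) * (\<Sum>k<m. \<beta> ^ k)"
  shows "joint_spectral_radius (b ^ (m - 1)) (adj_matrices b m) = \<beta>"
proof (rule joint_spectral_radius_eq)
  let ?z = "replicate m (0 :: nat)"
  have z: "?z \<in> digit_words b m"
    using b by (auto simp: digit_words_def)
  then show "adj_matrix b m ?z \<in> adj_matrices b m"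
    by (simp add: adj_matrices_def)
  \<comment> \<open>The words counted by a product are \<open>m - 1\<close> letters longer than the
    number of factors, whence the extra power of \<beta> in the constant.\<close>
  show "real b ^ m * \<beta> ^ (m - 1) > 0"
    using b \<beta> by simp
  show "\<beta> ^ n \<le> entry_norm (mat_prod (b ^ (m - 1)) (replicate n (adj_matrix b m ?z)))" for n
  proof (cases "n = 0")
    \<comment> \<open>The eigenvector argument needs a nonempty block; the empty product is the
      identity, of norm \<open>b ^ (m - 1)\<close>.\<close>
    case True
    then show ?thesis
      using entry_norm_mat_prod[OF m, of "[]" b] b
      by (simp add: avoiding_words_def card_digit_words)
  next
    case False
    have "\<beta> ^ n = real_spectral_radius (mat_prod (b ^ (m - 1)) (map (adj_matrix b m) (replicate n ?z)))"
      using False z \<beta> by (subst real_spectral_radius_progressively_overlapping[OF b m _ \<beta>(2)])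
        (auto simp: progressively_overlapping_replicate)
    also have "\<dots> \<le> entry_norm (mat_prod (b ^ (m - 1)) (map (adj_matrix b m) (replicate n ?z)))"
      using b by (intro real_spectral_radius_le_entry_norm[OF mat_prod_adj_matrix_carrier]) simp
    finally show ?thesis
      by (simp only: map_replicate)
  qed
  fix Ms assume Ms: "set Ms \<subseteq> adj_matrices b m"
  then have "Ms \<in> lists (adj_matrix b m ` digit_words b m)"
    by (auto simp: adj_matrices_def)
  then obtain ds where ds: "set ds \<subseteq> digit_words b m" "Ms = map (adj_matrix b m) ds"
    by (auto simp: lists_image)
  show "entry_norm (mat_prod (b ^ (m - 1)) Ms) \<le> real b ^ m * \<beta> ^ (m - 1) * \<beta> ^ length Ms"
    using card_avoiding_words_le_power[OF b \<beta> ds(1), of "m - 1 + length ds"] m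
    unfolding ds(2) entry_norm_mat_prod[OF m ds(1)] length_map power_add mult.assoc by linarith
qed (use \<beta>(1) in linarith)

subsection \<open>The Pisot root\<close>

text \<open>The factor \<open>x - 1\<close> telescopes the geometric sum. The resulting trinomial is
  easy to evaluate at \<open>x = c\<close> and to estimate in modulus.\<close>

lemma mult_geometric_polynomial:
  fixes x :: "'a::comm_ring_1"
  shows "(x - 1) * (x ^ m - (c - 1) * (\<Sum>k<m. x ^ k)) = x ^ Suc m - c * x ^ m + (c - 1)"
proof -
  have "(x - 1) * (x ^ m - (c - 1) * (\<Sum>k<m. x ^ k)) =
      x ^ Suc m - x ^ m - (c - 1) * ((x - 1) * (\<Sum>k<m. x ^ k))"
    by (simp add: algebra_simps)
  also have "(x - 1) * (\<Sum>k<m. x ^ k) = x ^ m - 1"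
    by (simp add: power_diff_1_eq)
  finally show ?thesis
    by (simp add: algebra_simps)
qed

text \<open>The quotient of \<open>x ^ m\<close> by the geometric sum is strictly increasing for
  positive \<open>x\<close>. Cleared of denominators, this is a termwise comparison of
  \<open>x ^ m * y ^ k\<close> with \<open>y ^ m * x ^ k\<close>.\<close>

lemma positive_root_unique:
  fixes x y c :: real
  assumes "m \<ge> 1" "c > 0" and x: "x > 0" "x ^ m = c * (\<Sum>k<m. x ^ k)"
    and y: "y > 0" "y ^ m = c * (\<Sum>k<m. y ^ k)"
  shows "x = y"
proof -
  have *: False if "0 < x" "x < y" "x ^ m = c * (\<Sum>k<m. x ^ k)" "y ^ m = c * (\<Sum>k<m. y ^ k)"
    for x y :: real
  proof -
    have "x ^ m * y ^ k < y ^ m * x ^ k" if "k < m" for k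
    proof -
      have "x ^ (m - k) < y ^ (m - k)"
        using \<open>0 < x\<close> \<open>x < y\<close> that by (intro power_strict_mono) auto
      then have "x ^ k * y ^ k * x ^ (m - k) < x ^ k * y ^ k * y ^ (m - k)"
        using \<open>0 < x\<close> \<open>x < y\<close> by (intro mult_strict_left_mono) auto
      moreover have "x ^ m = x ^ k * x ^ (m - k)" "y ^ m = y ^ k * y ^ (m - k)"
        using that by (simp_all flip: power_add)
      ultimately show ?thesis
        by (simp add: mult_ac)
    qed
    then have "(\<Sum>k<m. x ^ m * y ^ k) < (\<Sum>k<m. y ^ m * x ^ k)"
      using assms(1) by (intro sum_strict_mono) (auto simp: set_eq_iff intro: exI[of _ 0])
    then have "x ^ m * (c * (\<Sum>k<m. y ^ k)) < y ^ m * (c * (\<Sum>k<m. x ^ k))"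
      using assms(2) by (simp add: mult.left_commute[of _ c] flip: sum_distrib_left)
    then show False
      by (simp flip: that(3,4))
  qed
  show ?thesis
    using *[of x y] *[of y x] x y by (cases x y rule: linorder_cases) auto
qed

lemma exists_root_between:
  assumes "b \<ge> 2" and "m \<ge> 2"
  obtains \<beta> :: real where "real b - 1 < \<beta>" "\<beta> < real b"
    "\<beta> ^ m = (real b - 1) * (\<Sum>k<m. \<beta> ^ k)"
proof -
  define f where "f x = x ^ m - (real b - 1) * (\<Sum>k<m. x ^ k)" for x :: real
  obtain k where k: "m = Suc (Suc k)"
    using assms(2) by (metis add_2_eq_Suc le_iff_add)
  \<comment> \<open>At this point the top term of the sum cancels \<open>x ^ m\<close>; the terms
    left over, present since \<open>m \<ge> 2\<close>, make the value negative.\<close>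
  have "f (real b - 1) = - (real b - 1) * (\<Sum>j<Suc k. (real b - 1) ^ j)"
    unfolding f_def k sum.lessThan_Suc[of _ "Suc k"] by (simp add: algebra_simps)
  moreover have "(\<Sum>j<Suc k. (real b - 1) ^ j) > 0"
    using assms by (intro sum_pos) auto
  ultimately have left: "f (real b - 1) < 0"
    using assms by (simp add: mult_neg_pos del: sum.lessThan_Suc)
  \<comment> \<open>At \<open>x = c\<close> the first two terms of the trinomial cancel, so
    \<open>f (real b)\<close> is \<open>1\<close>.\<close>
  have "(real b - 1) * f (real b) = real b - 1"
    unfolding f_def by (subst mult_geometric_polynomial) simp
  then have right: "f (real b) > 0"
    using assms by simp
  have "\<exists>x\<ge>real b - 1. x \<le> real b \<and> f x = 0"
    using left right by (intro IVT') (auto simp: f_def intro!: continuous_intros)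
  then obtain x where "x \<ge> real b - 1" "x \<le> real b" "f x = 0"
    by auto
  moreover from this have "x \<noteq> real b - 1" "x \<noteq> real b"
    using left right by auto
  ultimately show ?thesis
    by (intro that[of x]) (auto simp: f_def)
qed

text \<open>Comparing squared moduli leaves \<open>norm w = Re w\<close>, which forces the imaginary
  part to vanish.\<close>

lemma norm_add_of_real_eqD:
  fixes w :: complex
  assumes "norm (w + of_real a) = norm w + a" and "a > 0"
  shows "w = of_real (norm w)"
proof -
  have sq: "(norm w)\<^sup>2 = (Re w)\<^sup>2 + (Im w)\<^sup>2"
    by (rule cmod_power2)
  have "(norm w + a)\<^sup>2 = (Re w + a)\<^sup>2 + (Im w)\<^sup>2"
    unfolding assms(1)[symmetric] cmod_power2 by simp
  then have "a * norm w = a * Re w"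
    using sq by (simp add: power2_sum)
  then have "norm w = Re w"
    using assms(2) by simp
  with sq show ?thesis
    by (simp add: complex_eq_iff)
qed

text \<open>
  With \<open>r = norm z\<close>, the equation and \<open>mult_geometric_polynomial\<close> force equality in
  \<open>norm (z ^ Suc m + (c - 1)) \<le> r ^ Suc m + (c - 1)\<close>, so \<open>z ^ Suc m\<close> and \<open>z ^ m\<close> are positive.
\<close>

lemma root_of_large_norm:
  fixes z :: complex and c :: real
  assumes c: "c > 1" and z: "z ^ m = (of_real c - 1) * (\<Sum>k<m. z ^ k)" and "norm z \<ge> 1"
  shows "z = of_real (norm z)"
proof -
  define r where "r = norm z"
  have r: "r \<ge> 1"
    using assms by (simp add: r_def)
  have "(z - 1) * (z ^ m - (of_real c - 1) * (\<Sum>k<m. z ^ k)) = 0"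
    using z by simp
  then have eq: "of_real c * z ^ m = z ^ Suc m + of_real (c - 1)"
    unfolding mult_geometric_polynomial by (simp add: algebra_simps)
  have nc: "norm (complex_of_real (c - 1)) = c - 1"
    using c by (simp only: norm_of_real)
  have "r ^ m = (c - 1) * norm (\<Sum>k<m. z ^ k)"
    using arg_cong[OF z, of norm] nc by (simp add: r_def norm_power norm_mult)
  also have "\<dots> \<le> (c - 1) * (\<Sum>k<m. r ^ k)"
    using c sum_norm_le[of "{..<m}" "\<lambda>k. z ^ k" "\<lambda>k. r ^ k"]
    by (intro mult_left_mono) (auto simp: r_def norm_power)
  \<comment> \<open>Here \<open>norm z \<ge> 1\<close> enters: the factor \<open>r - 1\<close> must
    not reverse the inequality.\<close>
  finally have "(r - 1) * (r ^ m - (c - 1) * (\<Sum>k<m. r ^ k)) \<le> 0"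
    using r by (intro mult_nonneg_nonpos) auto
  then have up: "r ^ Suc m + (c - 1) \<le> c * r ^ m"
    unfolding mult_geometric_polynomial by simp
  have "norm (of_real c * z ^ m) = c * r ^ m"
    using c by (simp add: norm_mult norm_power r_def)
  then have eqn: "norm (z ^ Suc m + of_real (c - 1)) = c * r ^ m"
    by (simp only: eq)
  have nz: "norm (z ^ Suc m) = r ^ Suc m"
    by (simp add: norm_mult norm_power r_def)
  \<comment> \<open>\<open>up\<close> and \<open>eqn\<close> bound the norm from below by the value
    that the triangle inequality gives from above.\<close>
  have teq: "norm (z ^ Suc m + of_real (c - 1)) = r ^ Suc m + (c - 1)"
    using up eqn nz norm_triangle_ineq[of "z ^ Suc m" "of_real (c - 1)"] nc by linarith
  then have z1: "z ^ Suc m = of_real (r ^ Suc m)"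
    using norm_add_of_real_eqD[of "z ^ Suc m" "c - 1"] c nz by simp
  have "c * r ^ m = r ^ Suc m + (c - 1)"
    using teq eqn by simp
  then have "of_real c * z ^ m = of_real c * of_real (r ^ m)"
    unfolding eq z1 by (metis of_real_add of_real_mult)
  then have "z ^ m = of_real (r ^ m)"
    using c by simp
  with z1 have "z * of_real (r ^ m) = of_real r * of_real (r ^ m)"
    by simp
  then show ?thesis
    using r by (auto simp: r_def)
qed

text \<open>The remainder \<open>f mod p\<close> also vanishes at \<open>x\<close>, so minimality of
  the degree forces it to be zero.\<close>

lemma minimal_poly_dvd:
  assumes p: "is_minimal_poly x p" and f: "poly (map_poly of_rat f) x = 0"
  shows "p dvd f"
proof -
  interpret of_rat: map_poly_comm_ring_hom "of_rat :: rat \<Rightarrow> complex" ..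
  have p0: "p \<noteq> 0"
    using p by (auto simp: is_minimal_poly_def)
  have "(map_poly of_rat f :: complex poly) =
      map_poly of_rat (f div p) * map_poly of_rat p + map_poly of_rat (f mod p)"
    by (simp only: of_rat.hom_mult[symmetric] of_rat.hom_add[symmetric] div_mult_mod_eq)
  then have "poly (map_poly of_rat (f mod p)) x = 0"
    using f p by (simp add: is_minimal_poly_def)
  then have "f mod p = 0"
    using p p0 degree_mod_less[of p f] by (force simp: is_minimal_poly_def)
  then show ?thesis
    by (simp add: mod_eq_0_iff_dvd)
qed

text \<open>The minimal polynomial divides the given one, so every conjugate solves the same
  equation. A conjugate of modulus at least \<open>1\<close> would be a positive real solution, and
  there is only one.\<close>

lemma pisot_number_root:
  assumes b: "b \<ge> 2" and m: "m \<ge> 1" and \<beta>: "\<beta> > 1" "\<beta> ^ m = (real b - 1) * (\<Sum>k<m. \<beta> ^ k)"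
  shows "pisot_number \<beta>"
proof -
  define f :: "int poly" where "f = monom 1 m - Polynomial.smult (int b - 1) (\<Sum>k<m. monom 1 k)"
  have coeff_f: "coeff f i = (if i = m then 1 else if i < m then 1 - int b else 0)" for i
    by (auto simp: f_def coeff_sum)
  have "degree f = m"
    by (intro antisym degree_le le_degree) (auto simp: coeff_f)
  then have lead: "lead_coeff f = 1"
    by (simp add: coeff_f)
  have ev: "poly (map_poly of_int f) x = x ^ m - (of_nat b - 1) * (\<Sum>k<m. x ^ k)"
    for x :: "'a::{field_char_0}"
    unfolding f_def by (simp add: hom_distribs poly_sum poly_monom)
  have "algebraic_int \<beta>"
    using lead \<beta> by (intro algebraic_int.intros[of "map_poly of_int f"]) (auto simp: ev)
  have "norm z < 1" if conj: "algebraic_conjugate (complex_of_real \<beta>) z" and "z \<noteq> complex_of_real \<beta>" for z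
  proof (rule ccontr)
    assume large: "\<not> norm z < 1"
    obtain p where p: "is_minimal_poly \<beta> p" "poly (map_poly of_rat p) z = 0"
      using conj by (auto simp: algebraic_conjugate_def)
    have rat: "map_poly of_rat (map_poly of_int f) = (map_poly of_int f :: complex poly)"
      by (simp add: map_poly_map_poly o_def)
    have "complex_of_real (\<beta> ^ m - (real b - 1) * (\<Sum>k<m. \<beta> ^ k)) = 0"
      using \<beta> by simp
    then have "poly (map_poly of_rat (map_poly of_int f)) (complex_of_real \<beta>) = 0"
      unfolding rat ev by simp
    then have "p dvd map_poly of_int f"
      by (rule minimal_poly_dvd[OF p(1)])
    then obtain q where q: "map_poly of_int f = p * q" ..
      interpret of_rat: map_poly_comm_ring_hom "of_rat :: rat \<Rightarrow> complex" ..
    have "poly (map_poly of_rat (map_poly of_int f)) z = 0"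
      unfolding q by (simp add: of_rat.hom_mult p)
    then have z: "z ^ m = (of_real (real b) - 1) * (\<Sum>k<m. z ^ k)"
      unfolding rat ev by simp
    then have zr: "z = of_real (norm z)"
      using root_of_large_norm[OF _ z] b large by simp
    \<comment> \<open>Replacing \<open>z\<close> by its modulus on both sides gives a real equation
      for \<open>norm z\<close>.\<close>
    have "complex_of_real (norm z ^ m) = of_real ((real b - 1) * (\<Sum>k<m. norm z ^ k))"
      using z by (subst (asm) (1 2) zr) simp
    then have "norm z ^ m = (real b - 1) * (\<Sum>k<m. norm z ^ k)"
      by (simp only: of_real_eq_iff)
    moreover have "real b - 1 > 0" "norm z > 0" "\<beta> > 0"
      using b large \<beta>(1) by linarith+
    ultimately have "norm z = \<beta>"
      using positive_root_unique[OF m] \<beta>(2) by blast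
    with zr \<open>z \<noteq> complex_of_real \<beta>\<close> show False by metis
  qed
  with \<open>algebraic_int \<beta>\<close> \<beta> show ?thesis
    by (simp add: pisot_number_def)
qed

section \<open>Finiteness and the common value of the normalised spectral radii\<close>

theorem theorem1p13:
  fixes b m :: nat
  assumes "b \<ge> 3" and "m \<ge> 2"
  shows "finiteness_property (b ^ (m - 1)) (adj_matrices b m) \<and>
    (\<exists>\<beta>::real. real b - 1 < \<beta> \<and> \<beta> < real b \<and> pisot_number \<beta> \<and>
       \<beta> ^ m - (real b - 1) * (\<Sum>k<m. \<beta> ^ k) = 0 \<and>
       (\<forall>\<mu>. pisot_number \<mu> \<and> \<mu> ^ m - (real b - 1) * (\<Sum>k<m. \<mu> ^ k) = 0 \<longrightarrow> \<mu> = \<beta>) \<and>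
       (\<forall>n \<omega>s. n \<ge> 1 \<and> length \<omega>s = n \<and> set \<omega>s \<subseteq> digit_words b m \<and>
          progressively_overlapping (periodic_seq \<omega>s) \<longrightarrow>
          joint_spectral_radius (b ^ (m - 1)) (adj_matrices b m) =
            root n (real_spectral_radius (mat_prod (b ^ (m - 1)) (map (adj_matrix b m) \<omega>s))) \<and>
          root n (real_spectral_radius (mat_prod (b ^ (m - 1)) (map (adj_matrix b m) \<omega>s))) = \<beta>))"
proof (intro conjI)
  have b: "b \<ge> 1" "b \<ge> 2" and m: "m \<ge> 1" "m \<ge> 2"
    using assms by simp_all
  obtain \<beta> :: real where bounds: "real b - 1 < \<beta>" "\<beta> < real b"
    and root: "\<beta> ^ m = (real b - 1) * (\<Sum>k<m. \<beta> ^ k)"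
    using exists_root_between[OF b(2) m(2)] .
  have \<beta>: "\<beta> > 1"
    using bounds assms(1) by simp
  have jsr: "joint_spectral_radius (b ^ (m - 1)) (adj_matrices b m) = \<beta>"
    using \<beta> by (intro joint_spectral_radius_adj_matrices[OF b(1) m(2) _ root]) simp
  have rho: "root (length \<omega>s)
      (real_spectral_radius (mat_prod (b ^ (m - 1)) (map (adj_matrix b m) \<omega>s))) = \<beta>"
    if "\<omega>s \<noteq> []" "set \<omega>s \<subseteq> digit_words b m" "progressively_overlapping (periodic_seq \<omega>s)" for \<omega>s
    using that \<beta> real_spectral_radius_progressively_overlapping[OF b(1) m(2) _ root that(2,1,3)]
    by (simp add: real_root_power_cancel)
  show "finiteness_property (b ^ (m - 1)) (adj_matrices b m)"
  proof -
    \<comment> \<open>A single matrix attains the joint spectral radius: the block of length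
      \<open>1\<close> made of the zero word.\<close>
    let ?\<omega>s = "replicate 1 (replicate m 0)"
    have "set ?\<omega>s \<subseteq> digit_words b m"
      using b by (auto simp: digit_words_def)
    moreover from this have "set (map (adj_matrix b m) ?\<omega>s) \<subseteq> adj_matrices b m"
      by (auto simp: adj_matrices_def)
    ultimately show ?thesis
      unfolding finiteness_property_def
      using jsr rho[of ?\<omega>s] progressively_overlapping_replicate[of 1 m 0]
      by (intro exI[of _ 1] conjI exI[of _ "map (adj_matrix b m) ?\<omega>s"]) simp_all
  qed
  \<comment> \<open>Pisot numbers are positive, and the equation has one positive solution.\<close>
  have "\<mu> = \<beta>" if "pisot_number \<mu>" "\<mu> ^ m - (real b - 1) * (\<Sum>k<m. \<mu> ^ k) = 0" for \<mu>
  proof -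
    have "real b - 1 > 0" "\<mu> > 0" "\<beta> > 0" "\<mu> ^ m = (real b - 1) * (\<Sum>k<m. \<mu> ^ k)"
      using that assms(1) \<beta> by (simp_all add: pisot_number_def)
    then show ?thesis
      using positive_root_unique[OF m(1)] root by blast
  qed
  then show "\<exists>\<beta>::real. real b - 1 < \<beta> \<and> \<beta> < real b \<and> pisot_number \<beta> \<and>
       \<beta> ^ m - (real b - 1) * (\<Sum>k<m. \<beta> ^ k) = 0 \<and>
       (\<forall>\<mu>. pisot_number \<mu> \<and> \<mu> ^ m - (real b - 1) * (\<Sum>k<m. \<mu> ^ k) = 0 \<longrightarrow> \<mu> = \<beta>) \<and>
       (\<forall>n \<omega>s. n \<ge> 1 \<and> length \<omega>s = n \<and> set \<omega>s \<subseteq> digit_words b m \<and>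
          progressively_overlapping (periodic_seq \<omega>s) \<longrightarrow>
          joint_spectral_radius (b ^ (m - 1)) (adj_matrices b m) =
            root n (real_spectral_radius (mat_prod (b ^ (m - 1)) (map (adj_matrix b m) \<omega>s))) \<and>
          root n (real_spectral_radius (mat_prod (b ^ (m - 1)) (map (adj_matrix b m) \<omega>s))) = \<beta>)"
  proof (intro exI[of _ \<beta>] conjI allI impI)
    show "real b - 1 < \<beta>" "\<beta> < real b"
      by (fact bounds)+
    show "pisot_number \<beta>"
      by (rule pisot_number_root[OF b(2) m(1) \<beta> root])
    show "\<beta> ^ m - (real b - 1) * (\<Sum>k<m. \<beta> ^ k) = 0"
      using root by simp
  next
    fix n \<omega>s
    assume "n \<ge> 1 \<and> length \<omega>s = n \<and> set \<omega>s \<subseteq> digit_words b m \<and>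
      progressively_overlapping (periodic_seq \<omega>s)"
    moreover from this have "\<omega>s \<noteq> []" by auto
    ultimately have "root n (real_spectral_radius (mat_prod (b ^ (m - 1)) (map (adj_matrix b m) \<omega>s))) = \<beta>"
      using rho[of \<omega>s] by blast
    then show "joint_spectral_radius (b ^ (m - 1)) (adj_matrices b m) =
        root n (real_spectral_radius (mat_prod (b ^ (m - 1)) (map (adj_matrix b m) \<omega>s)))"
      and "root n (real_spectral_radius (mat_prod (b ^ (m - 1)) (map (adj_matrix b m) \<omega>s))) = \<beta>"
      using jsr by simp_all
  qed blast
qed

end
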